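(* Let $S=(a_1,\dots,a_n),(b_1,\dots,b_{n'})$ be a sequence of positive integers and let $H$ be a set of fixed edges and non-edges. Let $G=(V,U,E)$ and $G'=(V,U,E')$ be two different $H$-fixed realisations of $S$, where $H$ can be partitioned into sets $F$ and $F^*$ such that 1. $F$ does not contain a matching of size $3$, 2. $F^*\subseteq F'$, where $F'$ is the static edge and non-edge set of $S$, and 3. $F\cap F^*=\emptyset$. Then the $H$-ignoring swap algorithm and the $H$-ignoring Curveball algorithm sample an $H$-fixed realisation of $S$ uniformly at random for $t\to\infty$; that is, started in any $H$-fixed realisation, the distribution of the realisation reached after $t$ steps converges, as $t\to\infty$, to the uniform distribution on the set of all $H$-fixed realisations of $S$.
   Context: Let $V=\{v_1,\dots,v_n\}$ and $U=\{u_1,\dots,u_{n'}\}$ be disjoint finite vertex sets. $H=H_E\cup H_N$ where $H_E$ and $H_N$ are sets of vertex pairs $\{v_i,u_j\}$ with $v_i\in V$, $u_j\in U$ (fixed edges and fixed non-edges). A set of such pairs contains a matching of size 3 if it contains three pairwise vertex-disjoint pairs. A realisation of $S$ is a labeled simple bipartite graph $G=(V,U,E)$ (all edges between $V$ and $U$) with $d_G(v_i)=a_i$ for all $v_i\in V$ and $d_G(u_j)=b_j$ for all $u_j\in U$. It is $H$-fixed if moreover $H_E\subseteq E$ and $H_N\cap E=\emptyset$. The static edge and non-edge set $F'$ of $S$ is the set of all pairs $\{v_i,u_j\}$ that are edges in every realisation of $S$ or non-edges in every realisation of $S$. For a realisation $G$, let $A_i=\{u\in U:\{v_i,u\}\in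 E(G)\}$ be the adjacency list of $v_i\in V$, and let $H_i=\{u\in U:\{v_i,u\}\in H\}$ (containing both fixed neighbours and fixed non-neighbours of $v_i$). For $i\ne j$ put $A_{i-j}=A_i\setminus(H_i\cup A_j\cup H_j)$ and $A_{j-i}=A_j\setminus(H_j\cup A_i\cup H_i)$. An $H$-ignoring trade for $A_i,A_j$: choose a subset $B_{ij}$ of $A_{i-j}\cup A_{j-i}$ of size $|A_{i-j}|$, let $B_{ji}$ be the set of remaining elements of $A_{i-j}\cup A_{j-i}$, and replace $A_{i-j}$ by $B_{ij}$ in $A_i$ and $A_{j-i}$ by $B_{ji}$ in $A_j$. $H$-ignoring Curveball algorithm: start with an $H$-fixed realisation and repeat $t$ times independently: (a) choose two distinct adjacency lists $A_i,A_j$ uniformly at random; (b) choose an $H$-ignoring trade for $A_i,A_j$ uniformly at random (i.e. $B_{ij}$ uniformly among the subsets of $A_{i-j}\cup A_{j-i}$ of size $|A_{i-j}|$) and apply it. If no nontrivial trade exists, stay in the current realisation. $H$-ignoring swap algorithm: the same, but in step (b) $B_{ij}$ is chosen uniformly among those subsets of $A_{i-j}\cup A_{j-i}$ of size $|A_{i-j}|$ that differ from $A_{i-j}$ in at most one element (i.e. $|B_{ij}\setminus A_{i-j}|\le 1$), so that at most one pair of elements is exchanged, including the possibility of staying. If $n=1$ the algorithms stay in the current realisation. *)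

theory Defs
  imports "HOL-Probability.Probability"
begin

text \<open>
  Vertices are indexed from 0: the vertices of \<open>V\<close> are \<open>0, \<dots>, length a - 1\<close>, those of \<open>U\<close> are
  \<open>0, \<dots>, length b - 1\<close>.  The vertex pair \<open>{v\<^sub>i, u\<^sub>j}\<close> is represented by the ordered pair \<open>(i, j)\<close>,
  whose first component always names a vertex of \<open>V\<close> and whose second component a vertex of \<open>U\<close>;
  thus \<open>V\<close> and \<open>U\<close> are disjoint by construction, and a labelled simple bipartite graph on \<open>V\<close>, \<open>U\<close>
  is its edge set.
\<close>

type_synonym pairs = "(nat \<times> nat) set"

definition vertex_pairs :: "nat list \<Rightarrow> nat list \<Rightarrow> pairs" where
  "vertex_pairs a b = {..<length a} \<times> {..<length b}"

definition realisations :: "nat list \<Rightarrow> nat list \<Rightarrow> pairs set" where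
  "realisations a b = {E. E \<subseteq> vertex_pairs a b \<and>
     (\<forall>i<length a. card {j. (i, j) \<in> E} = a ! i) \<and>
     (\<forall>j<length b. card {i. (i, j) \<in> E} = b ! j)}"

definition fixed_realisations :: "nat list \<Rightarrow> nat list \<Rightarrow> pairs \<Rightarrow> pairs \<Rightarrow> pairs set" where
  "fixed_realisations a b HE HN = {E \<in> realisations a b. HE \<subseteq> E \<and> HN \<inter> E = {}}"

definition static_pairs :: "nat list \<Rightarrow> nat list \<Rightarrow> pairs" where
  "static_pairs a b = {e \<in> vertex_pairs a b.
     (\<forall>E\<in>realisations a b. e \<in> E) \<or> (\<forall>E\<in>realisations a b. e \<notin> E)}"

definition contains_matching :: "nat \<Rightarrow> pairs \<Rightarrow> bool" where
  "contains_matching k P \<longleftrightarrow> (\<exists>M\<subseteq>P. finite M \<and> card M = k \<and>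
     (\<forall>e\<in>M. \<forall>f\<in>M. e \<noteq> f \<longrightarrow> fst e \<noteq> fst f \<and> snd e \<noteq> snd f))"

definition adj :: "pairs \<Rightarrow> nat \<Rightarrow> nat set" where
  "adj P i = {j. (i, j) \<in> P}"

text \<open>The set \<open>A\<^sub>i\<^sub>-\<^sub>j\<close> for the realisation \<open>E\<close>, where \<open>A\<^sub>i = adj E i\<close> and \<open>H\<^sub>i = adj H i\<close>.\<close>

definition tradable :: "pairs \<Rightarrow> pairs \<Rightarrow> nat \<Rightarrow> nat \<Rightarrow> nat set" where
  "tradable H E i j = adj E i - (adj H i \<union> adj E j \<union> adj H j)"

definition curveball_trades :: "pairs \<Rightarrow> pairs \<Rightarrow> nat \<Rightarrow> nat \<Rightarrow> nat set set" where
  "curveball_trades H E i j =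
     {B. B \<subseteq> tradable H E i j \<union> tradable H E j i \<and> card B = card (tradable H E i j)}"

definition swap_trades :: "pairs \<Rightarrow> pairs \<Rightarrow> nat \<Rightarrow> nat \<Rightarrow> nat set set" where
  "swap_trades H E i j = {B \<in> curveball_trades H E i j. card (B - tradable H E i j) \<le> 1}"

definition apply_trade :: "pairs \<Rightarrow> pairs \<Rightarrow> nat \<Rightarrow> nat \<Rightarrow> nat set \<Rightarrow> pairs" where
  "apply_trade H E i j B =
     (E - ({i} \<times> tradable H E i j \<union> {j} \<times> tradable H E j i))
       \<union> {i} \<times> B \<union> {j} \<times> ((tradable H E i j \<union> tradable H E j i) - B)"

text \<open>
  One step of the Markov chain, parametrised by the set of admissible choices for \<open>B\<^sub>i\<^sub>j\<close>.  The choice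
  \<open>B\<^sub>i\<^sub>j = A\<^sub>i\<^sub>-\<^sub>j\<close> is always admissible and is the only one if there is no nontrivial trade, so that
  the chain then stays in its current state.
\<close>

definition trade_step ::
  "(pairs \<Rightarrow> pairs \<Rightarrow> nat \<Rightarrow> nat \<Rightarrow> nat set set) \<Rightarrow> nat \<Rightarrow> pairs \<Rightarrow> pairs \<Rightarrow> pairs pmf" where
  "trade_step trades n H E =
     (if n \<le> 1 then return_pmf E
      else do {
        (i, j) \<leftarrow> pmf_of_set {(i, j). i < n \<and> j < n \<and> i \<noteq> j};
        B \<leftarrow> pmf_of_set (trades H E i j);
        return_pmf (apply_trade H E i j B)
      })"

definition curveball_step :: "nat \<Rightarrow> pairs \<Rightarrow> pairs \<Rightarrow> pairs pmf" where
  "curveball_step = trade_step curveball_trades"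

definition swap_step :: "nat \<Rightarrow> pairs \<Rightarrow> pairs \<Rightarrow> pairs pmf" where
  "swap_step = trade_step swap_trades"

primrec run :: "('s \<Rightarrow> 's pmf) \<Rightarrow> nat \<Rightarrow> 's \<Rightarrow> 's pmf" where
  "run step 0 s = return_pmf s"
| "run step (Suc t) s = bind_pmf (run step t s) step"

text \<open>
  The state space is finite, so that convergence of the distributions is pointwise convergence of
  the probability mass functions.
\<close>

definition samples_uniformly :: "('s \<Rightarrow> 's pmf) \<Rightarrow> 's set \<Rightarrow> bool" where
  "samples_uniformly step X \<longleftrightarrow>
     (\<forall>s\<in>X. \<forall>x. (\<lambda>t. pmf (run step t s) x) \<longlonglongrightarrow> pmf (pmf_of_set X) x)"

end

theory Submission
  imports Defs
begin

text \<open>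
  Both chains are symmetric, because a trade and its reversal have the same number of alternatives,
  and they may stay in place; so it suffices to show that any two \<open>H\<close>-fixed realisations are connected
  by swaps.  A swap between two realisations cannot touch a static pair, hence only \<open>F\<close> has to be
  avoided.  The symmetric difference of two realisations contains alternating cycles
  \<open>p, f p, h p, f (h p), \<dots>\<close> disjoint from \<open>F\<close>, with \<open>(p, f p)\<close> an edge and \<open>(h p, f p)\<close> a non-edge.
  A cycle of length at least six has at least three chords \<open>(p, f (h p))\<close>, which form a matching, so one
  of them lies outside \<open>F\<close>.  It cuts the cycle into a four-cycle, which is a swap, and a shorter
  alternating cycle; the chord being a non-edge or an edge decides which of the two is flipped first.
\<close>

section \<open>Convergence of doubly stochastic chains\<close>

lemma pmf_bind_finite:
  assumes "finite X" and "set_pmf p \<subseteq> X"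
  shows "pmf (bind_pmf p f) y = (\<Sum>x\<in>X. pmf p x * pmf (f x) y)"
  using assms by (simp add: pmf_bind integral_measure_pmf_real[where A = X] subset_iff mult.commute)

lemma run_add: "run step (s + t) x = bind_pmf (run step s x) (run step t)"
  by (induction t) (simp_all add: bind_return_pmf' bind_assoc_pmf)

locale doubly_stochastic_chain =
  fixes step :: "'s \<Rightarrow> 's pmf" and X :: "'s set"
  assumes finite_X: "finite X"
    and nonempty: "X \<noteq> {}"
    and closed: "x \<in> X \<Longrightarrow> set_pmf (step x) \<subseteq> X"
    and column_sum: "y \<in> X \<Longrightarrow> (\<Sum>x\<in>X. pmf (step x) y) = 1"
    and lazy: "x \<in> X \<Longrightarrow> x \<in> set_pmf (step x)"
    and irreducible: "x \<in> X \<Longrightarrow> y \<in> X \<Longrightarrow> (\<lambda>x y. y \<in> set_pmf (step x))\<^sup>*\<^sup>* x y"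
begin

lemma run_closed: "x \<in> X \<Longrightarrow> set_pmf (run step t x) \<subseteq> X"
  using closed by (induction t) (auto simp: subset_iff)

lemma run_column_sum: "y \<in> X \<Longrightarrow> (\<Sum>x\<in>X. pmf (run step t x) y) = 1"
proof (induction t arbitrary: y)
  case 0
  then show ?case by (simp add: finite_X indicator_def if_distrib cong: if_cong)
next
  case (Suc t)
  have "(\<Sum>x\<in>X. pmf (run step (Suc t) x) y)
      = (\<Sum>x\<in>X. \<Sum>z\<in>X. pmf (run step t x) z * pmf (step z) y)"
    by (intro sum.cong) (simp_all add: pmf_bind_finite[OF finite_X run_closed])
  also have "\<dots> = (\<Sum>z\<in>X. (\<Sum>x\<in>X. pmf (run step t x) z) * pmf (step z) y)"
    by (subst sum.swap) (simp add: sum_distrib_right)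
  also have "\<dots> = 1"
    using Suc by (simp add: column_sum)
  finally show ?case .
qed

lemma run_row_sum: "x \<in> X \<Longrightarrow> (\<Sum>y\<in>X. pmf (run step t x) y) = 1"
  by (simp add: sum_pmf_eq_1 finite_X run_closed)

lemma run_mono:
  assumes "x \<in> X" and "s \<le> t"
  shows "set_pmf (run step s x) \<subseteq> set_pmf (run step t x)"
  using assms(2)
proof (induction t rule: dec_induct)
  case (step t)
  have "set_pmf (run step t x) \<subseteq> set_pmf (run step (Suc t) x)"
    using run_closed[OF assms(1), of t] lazy by (auto simp: subset_iff)
  with step.IH show ?case by blast
qed simp

lemma run_reaches:
  assumes "x \<in> X" and "y \<in> X"
  shows "\<exists>t. y \<in> set_pmf (run step t x)"
  using irreducible[OF assms]
proof (induction rule: rtranclp_induct)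
  case base
  have "x \<in> set_pmf (run step 0 x)" by simp
  then show ?case by blast
next
  case (step y z)
  then obtain t where "y \<in> set_pmf (run step t x)" by blast
  with step.hyps have "z \<in> set_pmf (run step (Suc t) x)" by auto
  then show ?case by blast
qed

lemma run_positive: "\<exists>N. \<forall>x\<in>X. \<forall>y\<in>X. 0 < pmf (run step N x) y"
proof -
  obtain T where T: "\<And>x y. x \<in> X \<Longrightarrow> y \<in> X \<Longrightarrow> y \<in> set_pmf (run step (T x y) x)"
    using run_reaches by metis
  define N where "N = Max ((\<lambda>(x, y). T x y) ` (X \<times> X))"
  have "0 < pmf (run step N x) y" if "x \<in> X" "y \<in> X" for x y
  proof -
    have "T x y \<le> N"
      unfolding N_def using that finite_X by (intro Max_ge) auto
    then show ?thesis
      using T[OF that] run_mono[OF that(1)] by (auto intro: pmf_positive)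
  qed
  then show ?thesis by blast
qed

definition deviation :: "'s \<Rightarrow> nat \<Rightarrow> real" where
  "deviation s t = (\<Sum>x\<in>X. \<bar>pmf (run step t s) x - 1 / card X\<bar>)"

text \<open>
  As the deviation from uniformity sums to zero, the constant \<open>\<delta>\<close> can be subtracted from all
  transition probabilities without changing the image of the deviation.
\<close>

lemma deviation_contracts:
  fixes \<delta> :: real
  assumes "s \<in> X" and \<delta>: "\<And>x y. x \<in> X \<Longrightarrow> y \<in> X \<Longrightarrow> \<delta> \<le> pmf (run step N x) y"
  shows "deviation s (t + N) \<le> (1 - card X * \<delta>) * deviation s t"
proof -
  let ?Q = "\<lambda>x y. pmf (run step N x) y" and ?u = "1 / real (card X)"
  let ?g = "\<lambda>x. pmf (run step t s) x - ?u"
  have card: "card X > 0" using finite_X nonempty by (simp add: card_gt_0_iff)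
  have sum_g: "(\<Sum>x\<in>X. ?g x) = 0"
    using card by (simp add: sum_subtractf run_row_sum[OF assms(1)])
  have eq: "pmf (run step (t + N) s) y - ?u = (\<Sum>x\<in>X. ?g x * (?Q x y - \<delta>))" if "y \<in> X" for y
  proof -
    have "(\<Sum>x\<in>X. ?g x * (?Q x y - \<delta>)) = (\<Sum>x\<in>X. ?g x * ?Q x y) - (\<Sum>x\<in>X. ?g x) * \<delta>"
      by (subst sum_distrib_right, subst sum_subtractf[symmetric]) (simp only: right_diff_distrib)
    also have "\<dots> = (\<Sum>x\<in>X. pmf (run step t s) x * ?Q x y) - ?u * (\<Sum>x\<in>X. ?Q x y)"
      unfolding sum_g by (simp add: left_diff_distrib sum_subtractf sum_distrib_left)
    also have "\<dots> = pmf (run step (t + N) s) y - ?u"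
      unfolding run_column_sum[OF that] run_add
      by (simp add: pmf_bind_finite[OF finite_X run_closed[OF assms(1)]])
    finally show ?thesis by simp
  qed
  have "deviation s (t + N) = (\<Sum>y\<in>X. \<bar>\<Sum>x\<in>X. ?g x * (?Q x y - \<delta>)\<bar>)"
    unfolding deviation_def by (intro sum.cong refl arg_cong[where f = abs] eq)
  also have "\<dots> \<le> (\<Sum>y\<in>X. \<Sum>x\<in>X. \<bar>?g x\<bar> * (?Q x y - \<delta>))"
    by (intro sum_mono order.trans[OF sum_abs]) (simp add: abs_mult \<delta>)
  also have "\<dots> = (\<Sum>x\<in>X. \<bar>?g x\<bar> * (\<Sum>y\<in>X. ?Q x y - \<delta>))"
    by (subst sum.swap) (simp only: sum_distrib_left)
  also have "\<dots> = (\<Sum>x\<in>X. \<bar>?g x\<bar> * (1 - card X * \<delta>))"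
    by (intro sum.cong) (simp_all add: sum_subtractf run_row_sum)
  also have "\<dots> = (1 - card X * \<delta>) * deviation s t"
    unfolding deviation_def by (metis sum_distrib_right mult.commute)
  finally show ?thesis .
qed

lemma deviation_tendsto_0:
  assumes "s \<in> X"
  shows "deviation s \<longlonglongrightarrow> 0"
proof -
  obtain N where N: "\<And>x y. x \<in> X \<Longrightarrow> y \<in> X \<Longrightarrow> 0 < pmf (run step N x) y"
    using run_positive by blast
  define \<delta> where "\<delta> = Min ((\<lambda>(x, y). pmf (run step N x) y) ` (X \<times> X))"
  have "\<delta> > 0"
    unfolding \<delta>_def using finite_X nonempty N by (subst Min_gr_iff) auto
  have \<delta>: "\<delta> \<le> pmf (run step N x) y" if "x \<in> X" "y \<in> X" for x y
    unfolding \<delta>_def using that finite_X by (intro Min_le) auto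
  have nonneg: "0 \<le> deviation s t" for t
    by (simp add: deviation_def sum_nonneg)
  have "deviation s (Suc t) \<le> deviation s t" for t
    using deviation_contracts[OF assms, of 0 1 t] by simp
  then have "decseq (deviation s)"
    by (rule decseq_SucI)
  then obtain L where L: "deviation s \<longlonglongrightarrow> L"
    using decseq_convergent[of "deviation s" 0] nonneg by blast
  have "(\<lambda>t. deviation s (t + N)) \<longlonglongrightarrow> L"
    using L by (rule LIMSEQ_ignore_initial_segment)
  moreover have "(\<lambda>t. (1 - card X * \<delta>) * deviation s t) \<longlonglongrightarrow> (1 - card X * \<delta>) * L"
    using L by (intro tendsto_intros)
  ultimately have "L \<le> (1 - card X * \<delta>) * L"
    by (rule LIMSEQ_le) (use deviation_contracts[OF assms \<delta>] in blast)
  then have "card X * \<delta> * L \<le> 0"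
    by (simp add: algebra_simps)
  moreover have "card X * \<delta> > 0"
    using finite_X nonempty \<open>\<delta> > 0\<close> by (simp add: card_gt_0_iff)
  ultimately have "L \<le> 0"
    by (meson mult_pos_pos not_le)
  moreover have "L \<ge> 0"
    using L nonneg by (intro LIMSEQ_le_const) auto
  ultimately show ?thesis using L by simp
qed

lemma samples_uniformly: "samples_uniformly step X"
  unfolding samples_uniformly_def
proof (intro ballI allI)
  fix s x
  assume s: "s \<in> X"
  show "(\<lambda>t. pmf (run step t s) x) \<longlonglongrightarrow> pmf (pmf_of_set X) x"
  proof (cases "x \<in> X")
    case True
    have "(\<lambda>t. pmf (run step t s) x - 1 / card X) \<longlonglongrightarrow> 0"
    proof (rule Lim_null_comparison[OF _ deviation_tendsto_0[OF s]])
      show "\<forall>\<^sub>F t in sequentially. norm (pmf (run step t s) x - 1 / card X) \<le> deviation s t"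
        unfolding deviation_def real_norm_def
        by (intro always_eventually allI member_le_sum True finite_X) simp
    qed
    then show ?thesis
      using True finite_X nonempty by (simp add: LIM_zero_iff)
  next
    case False
    then have "pmf (run step t s) x = 0" for t
      using run_closed[OF s] by (auto simp: pmf_eq_0_set_pmf)
    then show ?thesis
      using False finite_X nonempty by simp
  qed
qed

end

section \<open>Trades\<close>

lemma
  assumes "i \<noteq> j" and "B \<subseteq> tradable H E i j \<union> tradable H E j i"
  shows tradable_apply_trade: "tradable H (apply_trade H E i j B) i j = B"
    and tradable_apply_trade': "tradable H (apply_trade H E i j B) j i
          = (tradable H E i j \<union> tradable H E j i) - B"
  using assms by (auto simp: tradable_def apply_trade_def adj_def)

lemma apply_trade_undo:
  assumes "i \<noteq> j" and "B \<subseteq> tradable H E i j \<union> tradable H E j i"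
  shows "apply_trade H (apply_trade H E i j B) i j (tradable H E i j) = E"
proof -
  have "B \<union> (tradable H E i j \<union> tradable H E j i - B) = tradable H E i j \<union> tradable H E j i"
    using assms by auto
  then show ?thesis
    unfolding apply_trade_def[of H "apply_trade H E i j B"]
      tradable_apply_trade[OF assms] tradable_apply_trade'[OF assms]
    using assms by (auto simp: apply_trade_def tradable_def adj_def)
qed

lemma tradable_disjoint: "tradable H E i j \<inter> tradable H E j i = {}"
  by (auto simp: tradable_def)

lemma finite_tradable: "finite E \<Longrightarrow> finite (tradable H E i j)"
proof -
  assume "finite E"
  moreover have "tradable H E i j \<subseteq> snd ` E"
    by (force simp: tradable_def adj_def)
  ultimately show ?thesis by (simp add: finite_surj)
qed

lemma finite_curveball_trades:
  assumes "finite E"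
  shows "finite (curveball_trades H E i j)"
proof (rule finite_subset)
  show "curveball_trades H E i j \<subseteq> Pow (tradable H E i j \<union> tradable H E j i)"
    by (auto simp: curveball_trades_def)
qed (use assms in \<open>simp add: finite_tradable\<close>)

lemma apply_trade_agrees:
  assumes "B \<subseteq> tradable H E i j \<union> tradable H E j i" and "e \<in> H"
  shows "e \<in> apply_trade H E i j B \<longleftrightarrow> e \<in> E"
  using assms by (auto simp: apply_trade_def tradable_def adj_def)

lemma
  assumes "i \<noteq> j" and "B \<subseteq> tradable H E i j \<union> tradable H E j i"
  shows adj_apply_trade: "adj (apply_trade H E i j B) i = adj E i - tradable H E i j \<union> B"
    and adj_apply_trade': "adj (apply_trade H E i j B) j
      = adj E j - tradable H E j i \<union> (tradable H E i j \<union> tradable H E j i - B)"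
  using assms by (auto simp: apply_trade_def tradable_def adj_def)

lemma finite_realisation: "E \<in> realisations a b \<Longrightarrow> finite E"
  by (rule finite_subset[of _ "vertex_pairs a b"]) (auto simp: realisations_def vertex_pairs_def)

lemma finite_fixed_realisations: "finite (fixed_realisations a b HE HN)"
  by (rule finite_subset[of _ "Pow (vertex_pairs a b)"])
    (auto simp: fixed_realisations_def realisations_def vertex_pairs_def)

lemma card_column_apply_trade:
  assumes "finite E" and "i \<noteq> j" and "B \<subseteq> tradable H E i j \<union> tradable H E j i"
  shows "card {k. (k, u) \<in> apply_trade H E i j B} = card {k. (k, u) \<in> E}"
proof -
  let ?C = "{k. (k, u) \<in> E}" and ?C' = "{k. (k, u) \<in> apply_trade H E i j B}"
  have fin: "finite ?C"
    by (rule finite_subset[of _ "fst ` E"]) (use assms(1) in force)+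
  consider "?C' = ?C" | "i \<in> ?C" "j \<notin> ?C" "?C' = insert j (?C - {i})"
    | "j \<in> ?C" "i \<notin> ?C" "?C' = insert i (?C - {j})"
  proof -
    consider "u \<in> tradable H E i j - B" | "u \<in> tradable H E j i \<inter> B"
      | "u \<notin> tradable H E i j - B" "u \<notin> tradable H E j i \<inter> B" by blast
    then show ?thesis
    proof cases
      case 1
      then have "i \<in> ?C" "j \<notin> ?C" "?C' = insert j (?C - {i})"
        using assms(2,3) by (auto simp: tradable_def adj_def apply_trade_def)
      then show ?thesis by (rule that(2))
    next
      case 2
      then have "j \<in> ?C" "i \<notin> ?C" "?C' = insert i (?C - {j})"
        using assms(2,3) by (auto simp: tradable_def adj_def apply_trade_def)
      then show ?thesis by (rule that(3))
    next
      case 3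
      then have "?C' = ?C"
        using assms(2,3) by (auto simp: tradable_def adj_def apply_trade_def)
      then show ?thesis by (rule that(1))
    qed
  qed
  then show ?thesis
    by cases (use fin card_Suc_Diff1[OF fin] in simp_all)
qed

lemma apply_trade_realisation:
  assumes E: "E \<in> realisations a b" and ij: "i < length a" "j < length a" "i \<noteq> j"
    and B: "B \<in> curveball_trades H E i j"
  shows "apply_trade H E i j B \<in> realisations a b"
proof -
  let ?E = "apply_trade H E i j B" and ?T = "tradable H E i j" and ?T' = "tradable H E j i"
  have sub: "B \<subseteq> ?T \<union> ?T'" and card_B: "card B = card ?T"
    using B by (auto simp: curveball_trades_def)
  have fin: "finite E" "finite ?T" "finite ?T'" "finite B"
    using E sub finite_subset[OF sub] by (auto simp: finite_realisation finite_tradable)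
  have fin_adj: "finite (adj E k)" for k
    by (rule finite_subset[of _ "snd ` E"]) (use fin(1) in \<open>force simp: adj_def\<close>)+
  have "?E \<subseteq> vertex_pairs a b"
    using E ij sub by (auto simp: realisations_def vertex_pairs_def apply_trade_def tradable_def adj_def)
  moreover have "card (adj ?E k) = card (adj E k)" for k
  proof -
    have "card (adj ?E i) = card (adj E i - ?T) + card B"
      unfolding adj_apply_trade[OF ij(3) sub]
      by (intro card_Un_disjoint) (use sub fin fin_adj in \<open>auto simp: tradable_def\<close>)
    also have "\<dots> = card (adj E i)"
      unfolding card_B using fin_adj fin
      by (subst card_Diff_subset) (auto simp: tradable_def intro!: le_add_diff_inverse2 card_mono)
    finally have i: "card (adj ?E i) = card (adj E i)" .
    have "card (?T \<union> ?T' - B) = card ?T'"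
      using sub fin card_B tradable_disjoint[of H E i j]
      by (simp add: card_Diff_subset card_Un_disjoint)
    moreover have "card (adj ?E j) = card (adj E j - ?T') + card (?T \<union> ?T' - B)"
      unfolding adj_apply_trade'[OF ij(3) sub]
      by (intro card_Un_disjoint) (use fin fin_adj in \<open>auto simp: tradable_def\<close>)
    ultimately have "card (adj ?E j) = card (adj E j - ?T') + card ?T'" by simp
    also have "\<dots> = card (adj E j)"
      using fin_adj fin
      by (subst card_Diff_subset) (auto simp: tradable_def intro!: le_add_diff_inverse2 card_mono)
    finally have j: "card (adj ?E j) = card (adj E j)" .
    have "adj ?E k = adj E k" if "k \<noteq> i" "k \<noteq> j"
      using that by (auto simp: adj_def apply_trade_def)
    with i j show ?thesis by metis
  qed
  ultimately show ?thesis
    using E card_column_apply_trade[OF fin(1) ij(3) sub]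
    by (simp add: realisations_def adj_def)
qed

lemma apply_trade_fixed_realisation:
  assumes "E \<in> fixed_realisations a b HE HN" and "i < length a" "j < length a" "i \<noteq> j"
    and B: "B \<in> curveball_trades (HE \<union> HN) E i j"
  shows "apply_trade (HE \<union> HN) E i j B \<in> fixed_realisations a b HE HN"
proof -
  have "B \<subseteq> tradable (HE \<union> HN) E i j \<union> tradable (HE \<union> HN) E j i"
    using B by (simp add: curveball_trades_def)
  note agrees = apply_trade_agrees[OF this]
  show ?thesis
    using assms agrees apply_trade_realisation[OF _ assms(2-5)]
    by (auto simp: fixed_realisations_def)
qed

locale trade_rule =
  fixes trades :: "pairs \<Rightarrow> pairs \<Rightarrow> nat \<Rightarrow> nat \<Rightarrow> nat set set"
  assumes trades_subset: "trades H E i j \<subseteq> curveball_trades H E i j"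
    and swaps_subset: "swap_trades H E i j \<subseteq> trades H E i j"
    and reverse: "\<And>H E i j B. finite E \<Longrightarrow> i \<noteq> j \<Longrightarrow> B \<in> trades H E i j \<Longrightarrow>
      tradable H E i j \<in> trades H (apply_trade H E i j B) i j"
    and card_reverse: "\<And>H E i j B. finite E \<Longrightarrow> i \<noteq> j \<Longrightarrow> B \<in> trades H E i j \<Longrightarrow>
      card (trades H (apply_trade H E i j B) i j) = card (trades H E i j)"
begin

lemma trivial_trade: "tradable H E i j \<in> trades H E i j"
  using swaps_subset[of H E i j] by (auto simp: swap_trades_def curveball_trades_def)

lemma finite_trades: "finite E \<Longrightarrow> finite (trades H E i j)"
  using finite_curveball_trades trades_subset by (rule finite_subset[rotated])

lemma trade_sub: "B \<in> trades H E i j \<Longrightarrow> B \<subseteq> tradable H E i j \<union> tradable H E j i"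
  using trades_subset[of H E i j] by (auto simp: curveball_trades_def)

abbreviation trade_pmf :: "pairs \<Rightarrow> nat \<Rightarrow> nat \<Rightarrow> pairs \<Rightarrow> pairs pmf" where
  "trade_pmf H i j E \<equiv> map_pmf (apply_trade H E i j) (pmf_of_set (trades H E i j))"

lemma trade_step_eq:
  "n \<ge> 2 \<Longrightarrow> trade_step trades n H E
    = bind_pmf (pmf_of_set {(i, j). i < n \<and> j < n \<and> i \<noteq> j}) (\<lambda>(i, j). trade_pmf H i j E)"
  by (simp add: trade_step_def map_pmf_def)

lemma set_pmf_index_pairs:
  fixes n :: nat
  assumes "n \<ge> 2"
  shows "set_pmf (pmf_of_set {(i, j). i < n \<and> j < n \<and> i \<noteq> j}) = {(i, j). i < n \<and> j < n \<and> i \<noteq> j}"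
proof (rule set_pmf_of_set)
  show "finite {(i, j). i < n \<and> j < n \<and> i \<noteq> j}"
    by (rule finite_subset[of _ "{..<n} \<times> {..<n}"]) auto
  have "(0, 1) \<in> {(i, j). i < n \<and> j < n \<and> i \<noteq> j}"
    using assms by simp
  then show "{(i, j). i < n \<and> j < n \<and> i \<noteq> j} \<noteq> {}" by blast
qed

lemma set_trade_step:
  assumes "n \<ge> 2" and "finite E"
  shows "set_pmf (trade_step trades n H E)
    = (\<Union>(i, j) \<in> {(i, j). i < n \<and> j < n \<and> i \<noteq> j}. apply_trade H E i j ` trades H E i j)"
proof -
  have "set_pmf (pmf_of_set (trades H E i j)) = trades H E i j" for i j
    using trivial_trade finite_trades[OF assms(2)] by (intro set_pmf_of_set) blast+
  then show ?thesis
    by (simp add: trade_step_eq[OF assms(1)] set_pmf_index_pairs[OF assms(1)] case_prod_beta)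
qed

lemma pmf_trade_pmf:
  assumes "finite E" and "i \<noteq> j"
  shows "pmf (trade_pmf H i j E) E'
    = (if E' \<in> apply_trade H E i j ` trades H E i j then 1 / card (trades H E i j) else 0)"
proof -
  have set: "set_pmf (pmf_of_set (trades H E i j)) = trades H E i j"
    using trivial_trade finite_trades[OF assms(1)] by (intro set_pmf_of_set) blast+
  have inj: "inj_on (apply_trade H E i j) (trades H E i j)"
    using tradable_apply_trade[OF assms(2) trade_sub] by (rule inj_on_inverseI)
  show ?thesis
  proof (cases "E' \<in> apply_trade H E i j ` trades H E i j")
    case True
    then obtain B where B: "B \<in> trades H E i j" "E' = apply_trade H E i j B" by blast
    then have "pmf (trade_pmf H i j E) E' = pmf (pmf_of_set (trades H E i j)) B"
      using inj by (simp add: pmf_map_inj set)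
    with B True finite_trades[OF assms(1)] show ?thesis
      by (subst (asm) pmf_of_set) auto
  next
    case False
    then show ?thesis by (simp add: pmf_eq_0_set_pmf set)
  qed
qed

lemma trade_pmf_sym:
  assumes "finite E" and "finite E'" and "i \<noteq> j"
  shows "pmf (trade_pmf H i j E) E' = pmf (trade_pmf H i j E') E"
proof -
  have undo: "E \<in> apply_trade H E' i j ` trades H E' i j \<and>
      card (trades H E' i j) = card (trades H E i j)"
    if "finite E" and E': "E' \<in> apply_trade H E i j ` trades H E i j" for E E'
  proof -
    obtain B where B: "B \<in> trades H E i j" "E' = apply_trade H E i j B"
      using E' by blast
    show ?thesis
      using reverse[OF that(1) assms(3) B(1)] card_reverse[OF that(1) assms(3) B(1)]
        apply_trade_undo[OF assms(3) trade_sub[OF B(1)], symmetric] B(2)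
      by blast
  qed
  have "E' \<in> apply_trade H E i j ` trades H E i j \<longleftrightarrow> E \<in> apply_trade H E' i j ` trades H E' i j"
    using undo assms(1,2) by blast
  moreover have "card (trades H E' i j) = card (trades H E i j)"
    if "E' \<in> apply_trade H E i j ` trades H E i j"
    using undo[OF assms(1) that] by blast
  ultimately show ?thesis
    unfolding pmf_trade_pmf[OF assms(1,3)] pmf_trade_pmf[OF assms(2,3)] by simp
qed

lemma trade_step_sym:
  assumes "n \<ge> 2" and "finite E" and "finite E'"
  shows "pmf (trade_step trades n H E) E' = pmf (trade_step trades n H E') E"
  unfolding trade_step_eq[OF assms(1)] pmf_bind
proof (rule integral_cong_AE)
  show "AE x in measure_pmf (pmf_of_set {(i, j). i < n \<and> j < n \<and> i \<noteq> j}).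
      pmf (case x of (i, j) \<Rightarrow> trade_pmf H i j E) E' = pmf (case x of (i, j) \<Rightarrow> trade_pmf H i j E') E"
    using trade_pmf_sym[OF assms(2,3)]
    by (auto simp: AE_measure_pmf_iff set_pmf_index_pairs[OF assms(1)])
qed simp_all

end

interpretation curveball: trade_rule curveball_trades
proof
  fix H E i j B
  assume "i \<noteq> j" and B: "B \<in> curveball_trades H E i j"
  then have sub: "B \<subseteq> tradable H E i j \<union> tradable H E j i" and "card B = card (tradable H E i j)"
    by (auto simp: curveball_trades_def)
  moreover have "B \<union> (tradable H E i j \<union> tradable H E j i - B) = tradable H E i j \<union> tradable H E j i"
    using sub by blast
  ultimately have "curveball_trades H (apply_trade H E i j B) i j = curveball_trades H E i j"
    using tradable_apply_trade[OF \<open>i \<noteq> j\<close> sub] tradable_apply_trade'[OF \<open>i \<noteq> j\<close> sub]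
    by (simp add: curveball_trades_def)
  then show "tradable H E i j \<in> curveball_trades H (apply_trade H E i j B) i j"
    and "card (curveball_trades H (apply_trade H E i j B) i j) = card (curveball_trades H E i j)"
    by (simp_all add: curveball_trades_def)
qed (auto simp: swap_trades_def)

lemma card_near_subsets_le:
  assumes U: "finite U" and "S \<subseteq> U" "T \<subseteq> U" and card: "card S = card T"
  shows "card {B. B \<subseteq> U \<and> card B = k \<and> card (B - S) \<le> 1}
    \<le> card {B. B \<subseteq> U \<and> card B = k \<and> card (B - T) \<le> 1}"
proof -
  have fin: "finite S" "finite T"
    using assms finite_subset by auto
  obtain f where f: "bij_betw f S T"
    using fin card by (metis finite_same_card_bij)
  moreover obtain g where g: "bij_betw g (U - S) (U - T)"
    using assms fin by (metis card_Diff_subset finite_Diff finite_same_card_bij)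
  define \<pi> where "\<pi> x = (if x \<in> S then f x else g x)" for x
  have \<pi>S: "bij_betw \<pi> S T" and \<pi>U: "bij_betw \<pi> (U - S) (U - T)"
    using f g bij_betw_cong[of S \<pi> f T] bij_betw_cong[of "U - S" \<pi> g "U - T"]
    by (auto simp: \<pi>_def)
  then have "bij_betw \<pi> (S \<union> (U - S)) (T \<union> (U - T))"
    by (rule bij_betw_combine) auto
  moreover have "S \<union> (U - S) = U" "T \<union> (U - T) = U"
    using assms by auto
  ultimately have \<pi>: "bij_betw \<pi> U U" by simp
  have inj: "inj_on \<pi> U" and image: "\<pi> ` U = U"
    using \<pi> by (simp_all add: bij_betw_def)
  show ?thesis
  proof (rule card_inj_on_le)
    show "inj_on ((`) \<pi>) {B. B \<subseteq> U \<and> card B = k \<and> card (B - S) \<le> 1}"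
      using inj_on_image_eq_iff[OF inj] by (intro inj_onI) blast
    have "\<pi> ` B \<subseteq> U \<and> card (\<pi> ` B) = card B \<and> card (\<pi> ` B - T) \<le> 1"
      if B: "B \<subseteq> U" "card (B - S) \<le> 1" for B
    proof (intro conjI)
      show "\<pi> ` B \<subseteq> U" using B(1) image by blast
      show "card (\<pi> ` B) = card B"
        using inj_on_subset[OF inj B(1)] by (rule card_image)
      have "\<pi> ` (B - S) = \<pi> ` B - \<pi> ` S"
        using inj B(1) assms(2) by (intro inj_on_image_set_diff) auto
      also have "\<pi> ` S = T" using \<pi>S by (simp add: bij_betw_def)
      finally have "card (\<pi> ` B - T) = card (\<pi> ` (B - S))" by simp
      also have "\<dots> \<le> card (B - S)"
        using finite_subset[OF B(1) U] by (intro card_image_le) simp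
      finally show "card (\<pi> ` B - T) \<le> 1" using B(2) by simp
    qed
    then show "(`) \<pi> ` {B. B \<subseteq> U \<and> card B = k \<and> card (B - S) \<le> 1}
        \<subseteq> {B. B \<subseteq> U \<and> card B = k \<and> card (B - T) \<le> 1}"
      by blast
    show "finite {B. B \<subseteq> U \<and> card B = k \<and> card (B - T) \<le> 1}"
      using U by simp
  qed
qed

interpretation swap: trade_rule swap_trades
proof
  fix H E i j B
  assume E: "finite E" and "i \<noteq> j" and B: "B \<in> swap_trades H E i j"
  let ?T = "tradable H E i j" and ?U = "tradable H E i j \<union> tradable H E j i"
  have sub: "B \<subseteq> ?U" and card: "card B = card ?T" and near: "card (B - ?T) \<le> 1"
    using B by (auto simp: swap_trades_def curveball_trades_def)
  have fin: "finite ?U" using E by (simp add: finite_tradable)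
  have eq: "swap_trades H (apply_trade H E i j B) i j
      = {C. C \<subseteq> ?U \<and> card C = card ?T \<and> card (C - B) \<le> 1}"
    using sub card tradable_apply_trade[OF \<open>i \<noteq> j\<close> sub] tradable_apply_trade'[OF \<open>i \<noteq> j\<close> sub]
    by (simp add: swap_trades_def curveball_trades_def Un_absorb1)
  have "card (?T - B) \<le> card (B - ?T)"
    using fin sub card by (intro card_le_sym_Diff) (auto dest: finite_subset)
  with near show "?T \<in> swap_trades H (apply_trade H E i j B) i j"
    unfolding eq by simp
  have eq': "swap_trades H E i j = {C. C \<subseteq> ?U \<and> card C = card ?T \<and> card (C - ?T) \<le> 1}"
    by (auto simp: swap_trades_def curveball_trades_def)
  show "card (swap_trades H (apply_trade H E i j B) i j) = card (swap_trades H E i j)"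
    unfolding eq eq' by (intro antisym card_near_subsets_le) (use fin sub card in auto)
qed (auto simp: swap_trades_def)

section \<open>Connectedness\<close>

definition pair_swap :: "pairs \<Rightarrow> pairs \<Rightarrow> pairs \<Rightarrow> bool" where
  "pair_swap H E E' \<longleftrightarrow> (\<exists>i j u w. i \<noteq> j \<and> (i, u) \<in> E - H \<and> (j, w) \<in> E - H \<and>
     (i, w) \<notin> E \<union> H \<and> (j, u) \<notin> E \<union> H \<and> E' = E - {(i, u), (j, w)} \<union> {(i, w), (j, u)})"

text \<open>
  The alternating cycles \<open>p, f p, h p, f (h p), \<dots>\<close> given by the orbits of a permutation \<open>h\<close> of \<open>P\<close>:
  each pair \<open>(p, f p)\<close> is removed and each pair \<open>(h p, f p)\<close> is added.
\<close>

definition flip :: "pairs \<Rightarrow> nat set \<Rightarrow> (nat \<Rightarrow> nat) \<Rightarrow> (nat \<Rightarrow> nat) \<Rightarrow> pairs" where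
  "flip E P f h = E - (\<lambda>p. (p, f p)) ` P \<union> (\<lambda>p. (h p, f p)) ` P"

definition flippable :: "pairs \<Rightarrow> pairs \<Rightarrow> nat set \<Rightarrow> (nat \<Rightarrow> nat) \<Rightarrow> (nat \<Rightarrow> nat) \<Rightarrow> bool" where
  "flippable F E P f h \<longleftrightarrow> finite P \<and> inj_on f P \<and> h ` P = P \<and>
     (\<forall>p\<in>P. (p, f p) \<in> E - F \<and> (h p, f p) \<notin> E \<union> F)"

lemma pair_swap_chord:
  assumes "p \<noteq> q" and "(p, f p) \<in> E - F" and "(q, f q) \<in> E - F"
    and "(q, f p) \<notin> E \<union> F" and "(p, f q) \<notin> E \<union> F"
  shows "pair_swap F E (E - {(p, f p), (q, f q)} \<union> {(p, f q), (q, f p)})"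
  unfolding pair_swap_def
  by (intro exI[of _ p] exI[of _ q] exI[of _ "f p"] exI[of _ "f q"] conjI assms) simp

lemma flip_reachable:
  assumes "flippable F E P f h" and "\<not> contains_matching 3 F"
  shows "(pair_swap F)\<^sup>*\<^sup>* E (flip E P f h)"
  using assms(1)
proof (induction "card P" arbitrary: E P f h rule: less_induct)
  case less
  have fin: "finite P" and inj_f: "inj_on f P" and surj_h: "h ` P = P"
    and edge: "\<And>p. p \<in> P \<Longrightarrow> (p, f p) \<in> E - F"
    and non: "\<And>p. p \<in> P \<Longrightarrow> (h p, f p) \<notin> E \<union> F"
    using less.prems by (auto simp: flippable_def)
  have inj_h: "inj_on h P"
    using fin surj_h by (intro eq_card_imp_inj_on) auto
  have hP: "h p \<in> P" if "p \<in> P" for p using surj_h that by blast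
  have h_neq: "h p \<noteq> p" if "p \<in> P" for p
    using edge[OF that] non[OF that] by auto
  have f_eq: "f p = f q \<longleftrightarrow> p = q" if "p \<in> P" "q \<in> P" for p q
    using inj_f that by (auto simp: inj_on_def)
  have h_eq: "h p = h q \<longleftrightarrow> p = q" if "p \<in> P" "q \<in> P" for p q
    using inj_h that by (auto simp: inj_on_def)
  consider "P = {}" | p where "p \<in> P" "h (h p) = p"
    | "P \<noteq> {}" "\<And>p. p \<in> P \<Longrightarrow> h (h p) \<noteq> p" by blast
  then show ?case
  proof cases
    case 1
    then show ?thesis by (simp add: flip_def)
  next
    case (2 p)
    define q where "q = h p"
    have q: "q \<in> P" "q \<noteq> p" "h q = p"
      using 2 hP h_neq by (auto simp: q_def)
    define R where "R = P - {p, q}"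
    define E1 where "E1 = E - {(p, f p), (q, f q)} \<union> {(p, f q), (q, f p)}"
    have P: "P = insert p (insert q R)" and R: "p \<notin> R" "q \<notin> R" "R \<subseteq> P"
      using 2 q by (auto simp: R_def)
    have fR: "f s \<noteq> f p" "f s \<noteq> f q" if "s \<in> R" for s
      using that R 2 q f_eq by blast+
    have "(p, f q) \<notin> E \<union> F"
      using non[OF q(1)] q(3) by simp
    then have step: "pair_swap F E E1"
      unfolding E1_def using 2 q edge non[OF 2(1)] by (intro pair_swap_chord) (auto simp: q_def)
    have "h ` R = R"
    proof -
      have "h ` R = h ` P - h ` {p, q}"
        unfolding R_def using inj_h 2 q by (intro inj_on_image_set_diff) auto
      also have "\<dots> = R" using surj_h q(3) by (auto simp: R_def q_def)
      finally show ?thesis .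
    qed
    moreover have "(s, f s) \<in> E1 - F \<and> (h s, f s) \<notin> E1 \<union> F" if "s \<in> R" for s
      using edge[of s] non[of s] that R fR[OF that] by (auto simp: E1_def)
    ultimately have "flippable F E1 R f h"
      using fin inj_f R(3) by (auto simp: flippable_def R_def intro: inj_on_subset)
    moreover have "card R < card P"
      using fin 2(1) R by (intro psubset_card_mono) auto
    ultimately have "(pair_swap F)\<^sup>*\<^sup>* E1 (flip E1 R f h)"
      using less.hyps by blast
    moreover have "flip E1 R f h = flip E P f h"
      using fR by (auto simp: flip_def P E1_def q_def[symmetric] q(3))
    ultimately show ?thesis
      using step by (metis converse_rtranclp_into_rtranclp)
  next
    case 3
    txt \<open>The chords \<open>(p, f (h p))\<close> form a matching with at least three elements.\<close>
    obtain p where p: "p \<in> P" "(p, f (h p)) \<notin> F"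
    proof (rule ccontr)
      assume "\<not> thesis"
      with that have chords: "\<And>p. p \<in> P \<Longrightarrow> (p, f (h p)) \<in> F" by blast
      obtain p where p: "p \<in> P" using 3 by blast
      let ?q = "h p" and ?r = "h (h p)"
      let ?M = "(\<lambda>p. (p, f (h p))) ` {p, ?q, ?r}"
      have PP: "{p, ?q, ?r} \<subseteq> P" using p hP by blast
      have "card {p, ?q, ?r} = 3"
        using p hP h_neq[of p] h_neq[of ?q] 3(2)[of p] by auto
      then have "card ?M = 3"
        by (subst card_image) (auto intro: inj_onI)
      moreover have "?M \<subseteq> F" using chords PP by blast
      moreover have "\<forall>e\<in>?M. \<forall>e'\<in>?M. e \<noteq> e' \<longrightarrow> fst e \<noteq> fst e' \<and> snd e \<noteq> snd e'"
      proof -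
        have "f (h s) = f (h t) \<longleftrightarrow> s = t" if "s \<in> {p, ?q, ?r}" "t \<in> {p, ?q, ?r}" for s t
          using that PP f_eq h_eq hP by (meson subsetD)
        then show ?thesis by (auto simp del: insert_iff)
      qed
      ultimately have "contains_matching 3 F"
        unfolding contains_matching_def by (intro exI[of _ ?M]) simp
      with assms(2) show False by blast
    qed
    define q where "q = h p"
    define r where "r = h q"
    have q: "q \<in> P" "q \<noteq> p" and r: "r \<in> P" "r \<noteq> q" "r \<noteq> p"
      using p 3(2) hP h_neq by (auto simp: q_def r_def)
    define R where "R = P - {p, q}"
    have P: "P = insert p (insert q R)" and R: "p \<notin> R" "q \<notin> R" "R \<subseteq> P"
      using p q by (auto simp: R_def)
    have fR: "f s \<noteq> f p" "f s \<noteq> f q" if "s \<in> R" for s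
      using that R p(1) q f_eq by blast+
    have fpq: "f p \<noteq> f q" using f_eq p(1) q by blast
    have chord: "(p, f q) \<notin> F" using p by (simp add: q_def)
    have edges: "(p, f p) \<in> E - F" "(q, f q) \<in> E - F" "(q, f p) \<notin> E \<union> F" "(r, f q) \<notin> E \<union> F"
      using edge non p(1) q(1) by (auto simp: q_def r_def)
    define f' where "f' = f(p := f q)"
    define h' where "h' = h(p := r)"
    let ?Q = "insert p R"
    have imf: "(\<lambda>s. (s, f' s)) ` ?Q = insert (p, f q) ((\<lambda>s. (s, f s)) ` R)"
      using R by (auto simp: f'_def)
    have imh: "(\<lambda>s. (h' s, f' s)) ` ?Q = insert (r, f q) ((\<lambda>s. (h s, f s)) ` R)"
      using R by (auto simp: f'_def h'_def)
    have "h' ` ?Q = ?Q"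
    proof -
      have "h ` R = h ` P - h ` {p, q}"
        unfolding R_def using inj_h p q by (intro inj_on_image_set_diff) auto
      also have "\<dots> = P - {q, r}" using surj_h by (simp add: q_def r_def)
      finally have "h ` R = P - {q, r}" .
      moreover have "h' ` ?Q = insert r (h ` R)"
        using R by (auto simp: h'_def)
      ultimately show ?thesis using P q r R by auto
    qed
    moreover have "inj_on f' ?Q"
    proof -
      have "inj_on f' R"
        using inj_on_subset[OF inj_f R(3)] R(1) by (subst inj_on_cong[of R f' f]) (auto simp: f'_def)
      moreover have "f' p \<notin> f' ` (R - {p})"
      proof
        assume "f' p \<in> f' ` (R - {p})"
        then obtain s where "s \<in> R" "s \<noteq> p" "f' p = f' s" by blast
        then show False using fR(2)[of s] by (simp add: f'_def)
      qed
      ultimately show ?thesis by (simp only: inj_on_insert simp_thms)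
    qed
    ultimately have flippable: "flippable F E' ?Q f' h'"
      if "(p, f q) \<in> E'" "(r, f q) \<notin> E'" "\<And>s. s \<in> R \<Longrightarrow> (s, f s) \<in> E' \<and> (h s, f s) \<notin> E'" for E'
    proof -
      have "(s, f' s) \<in> E' - F \<and> (h' s, f' s) \<notin> E' \<union> F" if "s \<in> ?Q" for s
      proof (cases "s = p")
        case True
        then show ?thesis
          using \<open>(p, f q) \<in> E'\<close> \<open>(r, f q) \<notin> E'\<close> chord edges(4) by (simp add: f'_def h'_def)
      next
        case False
        then have "s \<in> R" "s \<in> P" using that R(3) by auto
        then show ?thesis
          using False edge[of s] non[of s] \<open>\<And>s. s \<in> R \<Longrightarrow> (s, f s) \<in> E' \<and> (h s, f s) \<notin> E'\<close>[of s]
          by (simp add: f'_def h'_def)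
      qed
      moreover have "finite ?Q" using fin by (simp add: R_def)
      ultimately show ?thesis
        using \<open>h' ` ?Q = ?Q\<close> \<open>inj_on f' ?Q\<close> unfolding flippable_def by blast
    qed
    have smaller: "card ?Q < card P"
      using fin q R by (intro psubset_card_mono) (auto simp: P)
    have E_R: "(s, f s) \<in> E" "(h s, f s) \<notin> E" if "s \<in> R" for s
      using edge non that R by blast+
    define D where "D = (\<lambda>s. (s, f s)) ` R"
    define D' where "D' = (\<lambda>s. (h s, f s)) ` R"
    have D: "(x, f p) \<notin> D" "(x, f q) \<notin> D" "(x, f p) \<notin> D'" "(x, f q) \<notin> D'" for x
      using fR[symmetric] by (auto simp: D_def D'_def)
    have D'_E: "D' \<inter> E = {}"
      using E_R by (auto simp: D'_def)
    have flip_P: "flip E P f h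
        = E - insert (p, f p) (insert (q, f q) D) \<union> insert (q, f p) (insert (r, f q) D')"
      by (simp add: flip_def P D_def D'_def q_def[symmetric] r_def[symmetric])
    have flip_Q: "flip E' ?Q f' h' = E' - insert (p, f q) D \<union> insert (r, f q) D'" for E'
      unfolding flip_def imf imh D_def D'_def ..
    show ?thesis
    proof (cases "(p, f q) \<in> E")
      case False
      define E1 where "E1 = E - {(p, f p), (q, f q)} \<union> {(p, f q), (q, f p)}"
      have "pair_swap F E E1"
        unfolding E1_def using edges chord False q by (intro pair_swap_chord) auto
      moreover have "flippable F E1 ?Q f' h'"
      proof (rule flippable)
        show "(p, f q) \<in> E1" "(r, f q) \<notin> E1"
          using edges r fpq by (auto simp: E1_def)
        show "(s, f s) \<in> E1 \<and> (h s, f s) \<notin> E1" if "s \<in> R" for s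
          using that E_R[OF that] fR[OF that] by (auto simp: E1_def)
      qed
      moreover have "flip E1 ?Q f' h' = flip E P f h"
        unfolding flip_P flip_Q E1_def using False D fpq by auto
      ultimately show ?thesis
        using less.hyps[OF smaller, of E1 f' h'] by (metis converse_rtranclp_into_rtranclp)
    next
      case True
      define E1 where "E1 = flip E ?Q f' h'"
      note E1 = E1_def[unfolded flip_Q]
      have "(pair_swap F)\<^sup>*\<^sup>* E E1"
        unfolding E1_def using True edges E_R by (intro less.hyps[OF smaller] flippable) blast+
      moreover have "pair_swap F E1 (E1 - {(p, f p), (q, f q)} \<union> {(p, f q), (q, f p)})"
      proof (rule pair_swap_chord)
        show "(p, f p) \<in> E1 - F" "(q, f q) \<in> E1 - F"
          using edges(1,2) fpq q D by (auto simp: E1)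
        show "(q, f p) \<notin> E1 \<union> F" "(p, f q) \<notin> E1 \<union> F"
          using edges chord fpq r D by (auto simp: E1)
      qed (use q in simp)
      moreover have "E1 - {(p, f p), (q, f q)} \<union> {(p, f q), (q, f p)} = flip E P f h"
        unfolding flip_P E1 using True fpq D D'_E edges q by auto
      ultimately show ?thesis by simp
    qed
  qed
qed

lemma finite_invariant_subset:
  assumes "finite V" and "V \<noteq> {}" and "h ` V \<subseteq> V"
  obtains P where "P \<subseteq> V" and "P \<noteq> {}" and "h ` P = P"
  using assms
proof (induction V arbitrary: thesis rule: finite_psubset_induct)
  case (psubset V)
  show ?case
  proof (cases "h ` V = V")
    case False
    then have "h ` V \<subset> V" using psubset.prems by blast
    moreover have "h ` V \<noteq> {}" "h ` (h ` V) \<subseteq> h ` V"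
      using psubset.prems by blast+
    ultimately obtain P where P: "P \<subseteq> h ` V" "P \<noteq> {}" "h ` P = P"
      using psubset.IH[of "h ` V"] by blast
    have "P \<subseteq> V" using P(1) psubset.prems(3) by (rule order.trans)
    then show ?thesis using P(2,3) by (rule psubset.prems(1))
  next
    case True
    show ?thesis by (rule psubset.prems(1)[OF order.refl psubset.prems(2) True])
  qed
qed

lemma card_eq_ex_diff:
  assumes "card A = card B" and "finite A" and "x \<in> A - B"
  shows "\<exists>y. y \<in> B - A"
proof (rule ccontr)
  assume "\<not> ?thesis"
  then have "B \<subset> A" using assms(3) by blast
  then have "card B < card A" using assms(2) by (intro psubset_card_mono)
  with assms(1) show False by simp
qed

lemma
  assumes "E \<in> realisations a b" and "E' \<in> realisations a b"
  shows realisations_row: "(i, u) \<in> E - E' \<Longrightarrow> \<exists>w. (i, w) \<in> E' - E"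
    and realisations_column: "(i, u) \<in> E - E' \<Longrightarrow> \<exists>j. (j, u) \<in> E' - E"
proof -
  have "finite E"
    using assms(1) by (rule finite_realisation)
  then have fin: "finite {w. (i, w) \<in> E}" "finite {j. (j, u) \<in> E}"
    by (force intro: finite_subset[of _ "snd ` E"], force intro: finite_subset[of _ "fst ` E"])
  assume iu: "(i, u) \<in> E - E'"
  then have "i < length a" "u < length b"
    using assms by (auto simp: realisations_def vertex_pairs_def)
  then have "card {w. (i, w) \<in> E} = card {w. (i, w) \<in> E'}"
    and "card {j. (j, u) \<in> E} = card {j. (j, u) \<in> E'}"
    using assms by (auto simp: realisations_def)
  note this[THEN card_eq_ex_diff]
  then show "\<exists>w. (i, w) \<in> E' - E" "\<exists>j. (j, u) \<in> E' - E"
    using iu fin by simp_all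
qed

lemma pair_swap_trade:
  assumes "pair_swap H E E'" and "finite E"
  shows "\<exists>i j B. i \<noteq> j \<and> i \<in> fst ` E \<and> j \<in> fst ` E \<and> B \<in> swap_trades H E i j \<and>
    E' = apply_trade H E i j B"
proof -
  obtain i j u w where *: "i \<noteq> j" "(i, u) \<in> E - H" "(j, w) \<in> E - H"
      "(i, w) \<notin> E \<union> H" "(j, u) \<notin> E \<union> H" and E': "E' = E - {(i, u), (j, w)} \<union> {(i, w), (j, u)}"
    using assms(1) unfolding pair_swap_def by blast
  let ?T = "tradable H E i j" and ?B = "insert w (tradable H E i j - {u})"
  have u: "u \<in> ?T" and w: "w \<in> tradable H E j i" "w \<notin> ?T"
    using * by (auto simp: tradable_def adj_def)
  have "card ?B = card ?T"
    using u w finite_tradable[OF assms(2), of H i j] card_Suc_Diff1[of ?T u] by simp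
  moreover have "card (?B - ?T) \<le> card {w}"
    by (intro card_mono) auto
  ultimately have "?B \<in> swap_trades H E i j"
    using w by (auto simp: swap_trades_def curveball_trades_def)
  moreover have "E' = apply_trade H E i j ?B"
    using * u w unfolding E' by (auto simp: apply_trade_def tradable_def adj_def)
  ultimately show ?thesis
    using * by force
qed

lemma pair_swap_realisation:
  assumes "pair_swap F E E'" and "E \<in> realisations a b"
  shows "E' \<in> realisations a b"
proof -
  obtain i j B where "i \<noteq> j" "i \<in> fst ` E" "j \<in> fst ` E" "B \<in> swap_trades F E i j"
      "E' = apply_trade F E i j B"
    using pair_swap_trade[OF assms(1) finite_realisation[OF assms(2)]] by blast
  moreover have "fst ` E \<subseteq> {..<length a}"
    using assms(2) by (auto simp: realisations_def vertex_pairs_def)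
  ultimately show ?thesis
    using assms(2) by (auto intro!: apply_trade_realisation simp: swap_trades_def)
qed

lemma pair_swaps_realisation:
  assumes "(pair_swap F)\<^sup>*\<^sup>* E E'" and "E \<in> realisations a b"
  shows "E' \<in> realisations a b"
  using assms by (induction rule: rtranclp_induct) (auto intro: pair_swap_realisation)

lemma pair_swap_connected:
  assumes "E \<in> realisations a b" and E': "E' \<in> realisations a b" and "E \<inter> F = E' \<inter> F"
    and F: "\<not> contains_matching 3 F"
  shows "(pair_swap F)\<^sup>*\<^sup>* E E'"
  using assms(1,3)
proof (induction "card (E - E')" arbitrary: E rule: less_induct)
  case less
  show ?case
  proof (cases "E = E'")
    case False
    let ?V = "fst ` (E - E')"
    have fin: "finite E" using less.prems by (simp add: finite_realisation)
    have "\<forall>i\<in>?V. \<exists>u. (i, u) \<in> E - E'" by force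
    then obtain f where f: "\<And>i. i \<in> ?V \<Longrightarrow> (i, f i) \<in> E - E'" by metis
    have "\<forall>u\<in>f ` ?V. \<exists>j. (j, u) \<in> E' - E"
      using f realisations_column[OF less.prems(1) E'] by blast
    then obtain g where "\<And>u. u \<in> f ` ?V \<Longrightarrow> (g u, u) \<in> E' - E" by metis
    moreover define h where "h = g \<circ> f"
    ultimately have h: "\<And>i. i \<in> ?V \<Longrightarrow> (h i, f i) \<in> E' - E" by simp
    have "E - E' \<noteq> {}"
    proof
      assume "E - E' = {}"
      moreover from this False obtain i u where "(i, u) \<in> E' - E" by auto
      ultimately show False
        using realisations_row[OF E' less.prems(1)] by blast
    qed
    then have "?V \<noteq> {}" by simp
    moreover have "h ` ?V \<subseteq> ?V"
    proof clarify
      fix i u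
      assume "(i, u) \<in> E" "(i, u) \<notin> E'"
      then have "(h i, f i) \<in> E' - E" by (intro h) force
      then obtain w where "(h i, w) \<in> E - E'"
        using realisations_row[OF E' less.prems(1)] by blast
      then show "h (fst (i, u)) \<in> ?V" by force
    qed
    ultimately obtain P where P: "P \<subseteq> ?V" "P \<noteq> {}" "h ` P = P"
      using fin by (metis finite_Diff finite_imageI finite_invariant_subset)
    have finP: "finite P" using P fin by (meson finite_Diff finite_imageI finite_subset)
    then have inj_h: "inj_on h P"
      using P(3) by (intro eq_card_imp_inj_on) auto
    define E1 where "E1 = flip E P f h"
    have edges: "(p, f p) \<in> E - E'" "(h p, f p) \<in> E' - E" if "p \<in> P" for p
      using that P f h by blast+
    have "inj_on f P"
      using inj_h unfolding h_def by (rule inj_on_imageI2)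
    moreover have "(p, f p) \<in> E - F" "(h p, f p) \<notin> E \<union> F" if "p \<in> P" for p
      using edges[OF that] less.prems(2) by blast+
    ultimately have "flippable F E P f h"
      using finP P(3) by (auto simp: flippable_def)
    then have reach: "(pair_swap F)\<^sup>*\<^sup>* E E1"
      unfolding E1_def using F by (rule flip_reachable)
    have "E1 - E' \<subset> E - E'"
    proof (rule psubsetI)
      show "E1 - E' \<subseteq> E - E'"
        using edges(2) by (auto simp: E1_def flip_def)
      obtain p where "p \<in> P" using P(2) by blast
      then have "(p, f p) \<notin> E1 - E'"
        using edges(2) by (auto simp: E1_def flip_def)
      with edges(1)[OF \<open>p \<in> P\<close>] show "E1 - E' \<noteq> E - E'" by blast
    qed
    then have "card (E1 - E') < card (E - E')"
      using fin by (intro psubset_card_mono) auto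
    moreover have "E1 \<inter> F = E' \<inter> F"
    proof -
      have "(p, f p) \<notin> F" "(h p, f p) \<notin> F" if "p \<in> P" for p
        using edges[OF that] less.prems(2) by blast+
      then have "E1 \<inter> F = E \<inter> F"
        by (auto simp: E1_def flip_def)
      with less.prems(2) show ?thesis by simp
    qed
    ultimately have "(pair_swap F)\<^sup>*\<^sup>* E1 E'"
      using less.hyps pair_swaps_realisation[OF reach less.prems(1)] by blast
    with reach show ?thesis by (rule rtranclp_trans)
  qed simp
qed

lemma pair_swap_avoids_static:
  assumes "pair_swap F E E'" and "E \<in> realisations a b" and "Fstar \<subseteq> static_pairs a b"
  shows "pair_swap (F \<union> Fstar) E E'"
proof -
  obtain i j u w where *: "i \<noteq> j" "(i, u) \<in> E - F" "(j, w) \<in> E - F"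
      "(i, w) \<notin> E \<union> F" "(j, u) \<notin> E \<union> F" and E': "E' = E - {(i, u), (j, w)} \<union> {(i, w), (j, u)}"
    using assms(1) unfolding pair_swap_def by blast
  have "E' \<in> realisations a b"
    using assms(1,2) by (rule pair_swap_realisation)
  then have "e \<notin> Fstar" if "e \<in> E - E' \<or> e \<in> E' - E" for e
    using that assms(2,3) by (auto simp: static_pairs_def)
  moreover have "u \<noteq> w" using * by blast
  ultimately have "(i, u) \<notin> Fstar" "(j, w) \<notin> Fstar" "(i, w) \<notin> Fstar" "(j, u) \<notin> Fstar"
    using * by (auto simp: E')
  with * E' show ?thesis
    unfolding pair_swap_def by blast
qed

context trade_rule
begin

lemma trade_step_pair_swap:
  assumes "pair_swap H E E'" and "finite E" and "fst ` E \<subseteq> {..<n}"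
  shows "n \<ge> 2 \<and> E' \<in> set_pmf (trade_step trades n H E)"
proof -
  obtain i j B where *: "i \<noteq> j" "i \<in> fst ` E" "j \<in> fst ` E" "B \<in> swap_trades H E i j"
      "E' = apply_trade H E i j B"
    using pair_swap_trade[OF assms(1,2)] by blast
  then have "i < n" "j < n" using assms(3) by blast+
  with * have "n \<ge> 2" by linarith
  then show ?thesis
    using * \<open>i < n\<close> \<open>j < n\<close> swaps_subset[of H E i j] by (auto simp: set_trade_step[OF _ assms(2)])
qed

lemma trade_step_closed:
  assumes "length a \<ge> 2" and "E \<in> fixed_realisations a b HE HN"
  shows "set_pmf (trade_step trades (length a) (HE \<union> HN) E) \<subseteq> fixed_realisations a b HE HN"
proof -
  have "finite E" using assms(2) finite_realisation by (auto simp: fixed_realisations_def)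
  then show ?thesis
    using assms(2) trades_subset apply_trade_fixed_realisation
    by (fastforce simp: set_trade_step[OF assms(1)])
qed

lemma trade_step_lazy:
  assumes "n \<ge> 2" and "finite E"
  shows "E \<in> set_pmf (trade_step trades n H E)"
proof -
  have "apply_trade H E 0 1 (tradable H E 0 1) = E"
    by (auto simp: apply_trade_def tradable_def adj_def)
  then have "E \<in> apply_trade H E 0 1 ` trades H E 0 1"
    using trivial_trade by (metis imageI)
  then show ?thesis
    unfolding set_trade_step[OF assms] using assms(1) by (intro UN_I[of "(0, 1)"]) simp_all
qed

lemma trade_step_samples_uniformly:
  fixes a b :: "nat list" and HE HN F Fstar G G' :: pairs
  assumes G: "G \<in> fixed_realisations a b HE HN" "G' \<in> fixed_realisations a b HE HN" "G \<noteq> G'"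
    and H: "HE \<union> HN = F \<union> Fstar" and F: "\<not> contains_matching 3 F"
    and static: "Fstar \<subseteq> static_pairs a b"
  shows "samples_uniformly (trade_step trades (length a) (HE \<union> HN)) (fixed_realisations a b HE HN)"
proof -
  let ?X = "fixed_realisations a b HE HN" and ?step = "trade_step trades (length a) (HE \<union> HN)"
  have real: "E \<in> realisations a b" if "E \<in> ?X" for E
    using that by (simp add: fixed_realisations_def)
  have swap_step: "length a \<ge> 2 \<and> E' \<in> set_pmf (?step E)"
    if "pair_swap F E E'" "E \<in> ?X" for E E'
  proof -
    have "pair_swap (HE \<union> HN) E E'"
      unfolding H using that(1) real[OF that(2)] static by (rule pair_swap_avoids_static)
    moreover have "fst ` E \<subseteq> {..<length a}"
      using real[OF that(2)] by (auto simp: realisations_def vertex_pairs_def)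
    ultimately show ?thesis
      using finite_realisation[OF real[OF that(2)]] by (intro trade_step_pair_swap)
  qed
  have connected: "(pair_swap F)\<^sup>*\<^sup>* E E'" if "E \<in> ?X" "E' \<in> ?X" for E E'
  proof (rule pair_swap_connected[OF real[OF that(1)] real[OF that(2)] _ F])
    show "E \<inter> F = E' \<inter> F"
      using that H by (auto simp: fixed_realisations_def)
  qed
  have n: "length a \<ge> 2"
    using connected[OF G(1,2)] G(3) swap_step[OF _ G(1)] by (metis converse_rtranclpE)
  have fin: "finite E" if "E \<in> ?X" for E
    using real[OF that] by (rule finite_realisation)
  interpret doubly_stochastic_chain ?step ?X
  proof
    show "finite ?X" by (rule finite_fixed_realisations)
    show "?X \<noteq> {}" using G by blast
    show closed: "set_pmf (?step E) \<subseteq> ?X" if "E \<in> ?X" for E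
      using n that by (rule trade_step_closed)
    show "(\<Sum>E\<in>?X. pmf (?step E) E') = 1" if "E' \<in> ?X" for E'
    proof -
      have "(\<Sum>E\<in>?X. pmf (?step E) E') = (\<Sum>E\<in>?X. pmf (?step E') E)"
        using n fin that by (intro sum.cong trade_step_sym) auto
      also have "\<dots> = 1"
        using closed[OF that] by (intro sum_pmf_eq_1 finite_fixed_realisations)
      finally show ?thesis .
    qed
    show "E \<in> set_pmf (?step E)" if "E \<in> ?X" for E
      using n fin[OF that] by (rule trade_step_lazy)
    show "(\<lambda>E E'. E' \<in> set_pmf (?step E))\<^sup>*\<^sup>* E E'" if "E \<in> ?X" "E' \<in> ?X" for E E'
    proof -
      have "(\<lambda>E E'. E' \<in> set_pmf (?step E))\<^sup>*\<^sup>* E E' \<and> E' \<in> ?X"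
        using connected[OF that]
      proof (induction rule: rtranclp_induct)
        case (step D D')
        then have "D' \<in> set_pmf (?step D)"
          using swap_step by blast
        then show ?case
          using step.IH closed by (meson rtranclp.rtrancl_into_rtrancl subsetD)
      qed (simp add: that)
      then show ?thesis ..
    qed
  qed
  show ?thesis by (rule samples_uniformly)
qed

end

theorem theorem2:
  fixes a b :: "nat list" and HE HN F Fstar G G' :: pairs
  assumes "\<forall>x\<in>set a. 0 < x" and "\<forall>y\<in>set b. 0 < y"
    and "HE \<subseteq> vertex_pairs a b" and "HN \<subseteq> vertex_pairs a b"
    and "G \<in> fixed_realisations a b HE HN" and "G' \<in> fixed_realisations a b HE HN" and "G \<noteq> G'"
    and "HE \<union> HN = F \<union> Fstar"
    and "\<not> contains_matching 3 F"
    and "Fstar \<subseteq> static_pairs a b"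
    and "F \<inter> Fstar = {}"
  shows "samples_uniformly (swap_step (length a) (HE \<union> HN)) (fixed_realisations a b HE HN)
       \<and> samples_uniformly (curveball_step (length a) (HE \<union> HN)) (fixed_realisations a b HE HN)"
  unfolding swap_step_def curveball_step_def
  using swap.trade_step_samples_uniformly[OF assms(5-10)]
    curveball.trade_step_samples_uniformly[OF assms(5-10)]
  by (rule conjI)

end
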